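(* Let $A\in\mathcal{M}_n(\mathbb{C})$, $B\in\mathcal{M}_m(\mathbb{C})$, and let $NR[B]$ be a polygon circumscribed to $NR[A]$. Then for all $\alpha,\beta\in\mathbb{R}\setminus\{0\}$ the geometric relationship of the numerical ranges $NR[\mathcal{L}(A,\alpha,\beta)]$ and $NR[\mathcal{L}(B,\alpha,\beta)]$ remains the same, that is, $NR[\mathcal{L}(B,\alpha,\beta)]$ is a polygon circumscribed to $NR[\mathcal{L}(A,\alpha,\beta)]$.
   Context: $\mathcal{M}_n(\mathbb{C})$ is the algebra of $n\times n$ complex matrices. The numerical range of an $n\times n$ matrix $A$ is $NR[A]=\{x^*Ax:\ x\in\mathbb{C}^n,\ x^*x=1\}$. The generalized Levinger transformation of $A$ is $\mathcal{L}(A,\alpha,\beta)=\alpha H_A+\beta S_A$, where $H_A=\frac{A+A^*}{2}$, $S_A=\frac{A-A^*}{2}$. A (convex) polygon is circumscribed to a compact convex set $K$ if it contains $K$ and each of its edges meets the boundary of $K$. *)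

theory Defs
  imports "HOL-Analysis.Analysis"
begin

definition conj_transpose :: "complex ^ 'n ^ 'm \<Rightarrow> complex ^ 'm ^ 'n" where
  "conj_transpose A = (\<chi> i j. cnj (A $ j $ i))"

text \<open>The product \<open>x\<^sup>* y\<close>, conjugate-linear in the first argument.
  The library's \<open>x \<bullet> y\<close> on this type is only its real part.\<close>

definition hprod :: "complex ^ 'n \<Rightarrow> complex ^ 'n \<Rightarrow> complex" where
  "hprod x y = (\<Sum>i\<in>UNIV. cnj (x $ i) * y $ i)"

definition numerical_range :: "complex ^ 'n ^ 'n \<Rightarrow> complex set" where
  "numerical_range A = {hprod x (A *v x) | x. hprod x x = 1}"

definition hermitian_part :: "complex ^ 'n ^ 'n \<Rightarrow> complex ^ 'n ^ 'n" where
  "hermitian_part A = (1 / 2) *\<^sub>R (A + conj_transpose A)"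

definition skew_hermitian_part :: "complex ^ 'n ^ 'n \<Rightarrow> complex ^ 'n ^ 'n" where
  "skew_hermitian_part A = (1 / 2) *\<^sub>R (A - conj_transpose A)"

definition levinger :: "complex ^ 'n ^ 'n \<Rightarrow> real \<Rightarrow> real \<Rightarrow> complex ^ 'n ^ 'n" where
  "levinger A \<alpha> \<beta> = \<alpha> *\<^sub>R hermitian_part A + \<beta> *\<^sub>R skew_hermitian_part A"

text \<open>Polygons are convex and non-degenerate: points and line segments are excluded.\<close>

definition convex_polygon :: "complex set \<Rightarrow> bool" where
  "convex_polygon P \<longleftrightarrow> polytope P \<and> aff_dim P = 2"

text \<open>The boundary is the topological boundary in the plane, so a set \<open>K\<close> contained
  in a line is its own boundary if it is closed. The notion is meant for compact convex \<open>K\<close>;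
  numerical ranges always have these properties, so they are not repeated here.\<close>

definition polygon_circumscribed_to :: "complex set \<Rightarrow> complex set \<Rightarrow> bool" where
  "polygon_circumscribed_to P K \<longleftrightarrow>
     convex_polygon P \<and> K \<subseteq> P \<and> (\<forall>e. e edge_of P \<longrightarrow> e \<inter> frontier K \<noteq> {})"

end

theory Submission
  imports Defs
begin

text \<open>
  The Levinger transformation acts on numerical ranges as a linear map of the plane. For every
  vector \<open>x\<close>, the number \<open>x\<^sup>* H x\<close> with \<open>H\<close> the Hermitian part of \<open>A\<close> is the real part of
  \<open>x\<^sup>* A x\<close>, and the skew-Hermitian part contributes the imaginary part. Weighting the two parts by
  \<open>\<alpha>\<close> and \<open>\<beta>\<close> therefore rescales the coordinate axes by \<open>\<alpha>\<close> and \<open>\<beta>\<close>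
  (\<open>numerical_range_levinger\<close>).

  When \<open>\<alpha>\<close> and \<open>\<beta>\<close> are nonzero this rescaling is a linear automorphism of the plane, the same one
  for \<open>A\<close> and \<open>B\<close>. Everything in the notion of a circumscribed polygon is invariant under such an
  automorphism: polytopes, affine dimension, faces, inclusion and topological boundary
  (\<open>polygon_circumscribed_to_linear_image\<close>).
\<close>

definition scale_axes :: "real \<Rightarrow> real \<Rightarrow> complex \<Rightarrow> complex" where
  "scale_axes \<alpha> \<beta> z = Complex (\<alpha> * Re z) (\<beta> * Im z)"

lemma linear_scale_axes: "linear (scale_axes \<alpha> \<beta>)"
  by (rule linearI) (simp_all add: scale_axes_def complex_eq_iff algebra_simps)

lemma inj_scale_axes:
  assumes "\<alpha> \<noteq> 0" "\<beta> \<noteq> 0"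
  shows "inj (scale_axes \<alpha> \<beta>)"
  using assms by (auto simp: inj_on_def scale_axes_def complex_eq_iff)

lemma hprod_add_right: "hprod x (y + z) = hprod x y + hprod x z"
  by (simp add: hprod_def algebra_simps sum.distrib)

lemma hprod_diff_right: "hprod x (y - z) = hprod x y - hprod x z"
  by (simp add: hprod_def algebra_simps sum_subtractf)

lemma hprod_scaleR_right: "hprod x (c *\<^sub>R y) = c *\<^sub>R hprod x y"
  by (simp add: hprod_def scaleR_sum_right)

lemma scaleR_complex_matrix_vector:
  fixes A :: "complex ^ 'n ^ 'm"
  shows "(c *\<^sub>R A) *v x = c *\<^sub>R (A *v x)"
  by (simp add: vec_eq_iff matrix_vector_mult_def scaleR_sum_right)

lemma hprod_conj_transpose:
  "hprod x (conj_transpose A *v y) = cnj (hprod y (A *v x))"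
proof -
  have "hprod x (conj_transpose A *v y) =
      (\<Sum>i\<in>UNIV. \<Sum>j\<in>UNIV. cnj (x $ i) * cnj (A $ j $ i) * y $ j)"
    by (simp add: hprod_def conj_transpose_def matrix_vector_mult_def sum_distrib_left mult.assoc)
  also have "\<dots> = (\<Sum>j\<in>UNIV. \<Sum>i\<in>UNIV. cnj (x $ i) * cnj (A $ j $ i) * y $ j)"
    by (rule sum.swap)
  also have "\<dots> = cnj (hprod y (A *v x))"
    by (simp add: hprod_def matrix_vector_mult_def sum_distrib_left mult_ac)
  finally show ?thesis .
qed

text \<open>
  The identity \<open>x\<^sup>* A\<^sup>* x = cnj (x\<^sup>* A x)\<close> turns the averages defining the Hermitian and the
  skew-Hermitian part into the real part and \<open>\<i>\<close> times the imaginary part.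
\<close>

lemma hprod_levinger:
  "hprod x (levinger A \<alpha> \<beta> *v x) = scale_axes \<alpha> \<beta> (hprod x (A *v x))"
  by (simp add: levinger_def hermitian_part_def skew_hermitian_part_def scaleR_complex_matrix_vector
      matrix_vector_mult_add_rdistrib matrix_vector_mult_diff_rdistrib
      hprod_add_right hprod_diff_right hprod_scaleR_right hprod_conj_transpose
      scale_axes_def complex_eq_iff field_simps)

lemma numerical_range_levinger:
  "numerical_range (levinger A \<alpha> \<beta>) = scale_axes \<alpha> \<beta> ` numerical_range A"
  by (auto simp: numerical_range_def hprod_levinger)

text \<open>
  Edges of the image are pulled back to edges of \<open>P\<close>, where the hypothesis supplies a point of the
  boundary of \<open>K\<close>. The boundary is that of the plane rather than the relative one, so its image is
  the boundary of the image because an injective linear map of the plane into itself is a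
  homeomorphism of the plane onto itself.
\<close>

lemma polygon_circumscribed_to_linear_image:
  assumes f: "linear f" "inj f" and PK: "polygon_circumscribed_to P K"
  shows "polygon_circumscribed_to (f ` P) (f ` K)"
  unfolding polygon_circumscribed_to_def
proof (intro conjI allI impI)
  have "polytope P" "aff_dim P = 2" "K \<subseteq> P"
    using PK by (auto simp: polygon_circumscribed_to_def convex_polygon_def)
  then show "convex_polygon (f ` P)" "f ` K \<subseteq> f ` P"
    using f by (auto simp: convex_polygon_def polytope_linear_image aff_dim_injective_linear_image)
next
  fix e assume e: "e edge_of f ` P"
  then have "e \<subseteq> f ` P"
    by (simp add: edge_of_def face_of_imp_subset)
  then obtain d where d: "e = f ` d"
    by (auto simp: subset_image_iff)
  have "d edge_of P"
    using e f by (simp add: d edge_of_def face_of_linear_image aff_dim_injective_linear_image)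
  then have "d \<inter> frontier K \<noteq> {}"
    using PK by (simp add: polygon_circumscribed_to_def)
  moreover have "frontier (f ` K) = f ` frontier K"
    using f by (simp add: frontier_def closure_injective_linear_image
        interior_injective_linear_image image_set_diff)
  ultimately show "e \<inter> frontier (f ` K) \<noteq> {}"
    by (auto simp: d)
qed

theorem proposition2:
  fixes A :: "complex ^ 'n ^ 'n" and B :: "complex ^ 'm ^ 'm"
  assumes "polygon_circumscribed_to (numerical_range B) (numerical_range A)"
  shows "\<forall>\<alpha> \<beta> :: real. \<alpha> \<noteq> 0 \<longrightarrow> \<beta> \<noteq> 0 \<longrightarrow>
    polygon_circumscribed_to (numerical_range (levinger B \<alpha> \<beta>)) (numerical_range (levinger A \<alpha> \<beta>))"
  using assms
  by (simp add: numerical_range_levinger polygon_circumscribed_to_linear_image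
      linear_scale_axes inj_scale_axes)

end
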